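(* (a) Let $T=T(l)$ be a finite labeled (unrooted) tree with $|V(T)|\geq 2$ such that $X=(V(T),d_l)$ is an ultrametric space. Then in the representing tree $T_X$ every inner node has at least one direct successor which is a leaf. (b) Conversely, let $(X,d)$, $|X|\geq 2$, be a finite ultrametric space such that in the representing tree $T_X$ every inner node has at least one direct successor which is a leaf. Then $X$ can be represented by a labeled unrooted tree, i.e. there exists a labeled unrooted tree $T=T(l)$ with $V(T)=X$ and $d_l=d$.
   Context: A labeled tree $T=T(l)$ is an unrooted tree $T$ (connected graph without cycles) together with a labeling function $l\colon V(T)\to[0,\infty)$. The mapping $d_l\colon V(T)\times V(T)\to[0,\infty)$ is defined by $d_l(u,v)=0$ if $u=v$, and $d_l(u,v)=\max_{w\in V(P)}l(w)$ if $u\neq v$, where $P$ is the path joining $u$ and $v$ in $T$ (endpoints included). Representing tree: let $(X,d)$ be a finite nonempty ultrametric space. If $|X|\geq 2$, the diametrical graph of $X$ is the graph with vertex set $X$ in which $u,v$ are adjacent iff $d(u,v)=\operatorname{diam}X$, where $\operatorname{diam} X=\max\{d(x,y):x,y\in X\}$; it is always complete $k$-partite for some $k\geq 2$, with uniquely determined nonempty parts $X_1,\dots,X_k$. The representing tree $(T_X,l_X)$ is the rooted labeled tree whose nodes are subsets of $X$, defined recursively: if $|X|=1$, $T_X$ consists of the single node $X$ labeled $0$; if $|X|\geq 2$, the root $X$ is labeled $\operatorname{diam}X$, its children (direct successors) are the parts $X_1,\dots,X_k$ of the diametrical graph of $X$, each child $X_i$ is labeled $l_X(X_i)=\operatorname{diam}X_i$,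 and the construction is repeated for every $X_i$ with $|X_i|\geq2$. The leaves of $T_X$ are exactly the singletons $\{x\}$, $x\in X$ (labeled $0$); the other nodes are inner (internal) nodes. *)

theory Defs
  imports
    "HOL-Analysis.Abstract_Metric_Spaces"
    "HOL-Library.Disjoint_Sets"
    "Graph_Theory.Graph_Theory"
begin

section \<open>Ultrametric spaces\<close>

text \<open>
  The locale \<open>Metric_space\<close> constrains its distance function also outside the carrier
  (nonnegativity and symmetry), hence the truncation: only the values of \<open>d\<close> on
  \<open>X \<times> X\<close> matter here.
\<close>

definition ultrametric_space :: "'a set \<Rightarrow> ('a \<Rightarrow> 'a \<Rightarrow> real) \<Rightarrow> bool" where
  "ultrametric_space X d \<longleftrightarrow>
     Metric_space X (\<lambda>x y. if x \<in> X \<and> y \<in> X then d x y else 0) \<and>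
     (\<forall>x\<in>X. \<forall>y\<in>X. \<forall>z\<in>X. d x z \<le> max (d x y) (d y z))"

lemma ultrametric_space_iff:
  "ultrametric_space X d \<longleftrightarrow>
     (\<forall>x\<in>X. \<forall>y\<in>X. 0 \<le> d x y \<and> (d x y = 0 \<longleftrightarrow> x = y) \<and> d x y = d y x) \<and>
     (\<forall>x\<in>X. \<forall>y\<in>X. \<forall>z\<in>X. d x z \<le> max (d x y) (d y z))"
  (is "_ \<longleftrightarrow> ?pt \<and> ?um")
proof
  let ?d = "\<lambda>x y. if x \<in> X \<and> y \<in> X then d x y else 0"
  assume u: "ultrametric_space X d"
  then interpret Metric_space X ?d
    by (simp add: ultrametric_space_def)
  have "0 \<le> d x y \<and> (d x y = 0 \<longleftrightarrow> x = y) \<and> d x y = d y x" if "x \<in> X" "y \<in> X" for x y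
    using nonneg[of x y] commute[of x y] zero[of x y] that by simp
  with u show "?pt \<and> ?um"
    by (simp add: ultrametric_space_def)
next
  assume pu: "?pt \<and> ?um"
  then have "d x z \<le> d x y + d y z" if "x \<in> X" "y \<in> X" "z \<in> X" for x y z
    using that by (smt (verit, best))
  with pu show "ultrametric_space X d"
    unfolding ultrametric_space_def by (auto simp: Metric_space_def)
qed

text \<open>Intended for finite nonempty \<open>A\<close>.\<close>

definition diam :: "('a \<Rightarrow> 'a \<Rightarrow> real) \<Rightarrow> 'a set \<Rightarrow> real" where
  "diam d A = Max {d x y | x y. x \<in> A \<and> y \<in> A}"


section \<open>Labeled unrooted trees\<close>

text \<open>
  Simple undirected graphs are symmetric loopfree digraphs without parallel arcs,
  i.e. \<open>pair_bidirected_digraph\<close>. The constant \<open>tree\<close> of \<open>Graph_Theory\<close> excludes directed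
  cycles and hence never holds for a symmetric digraph with an arc: the closed walk
  \<open>u, v, u\<close> is a \<open>cycle\<close> there. Cycles of an undirected graph are those of length at least 3.
\<close>

definition unrooted_tree :: "'a pair_pre_digraph \<Rightarrow> bool" where
  "unrooted_tree T \<longleftrightarrow>
     pair_bidirected_digraph T \<and>
     Digraph_Component.connected (with_proj T) \<and>
     (\<nexists>p. pre_digraph.cycle (with_proj T) p \<and> 3 \<le> length p)"

definition labeled_tree :: "'a pair_pre_digraph \<Rightarrow> ('a \<Rightarrow> real) \<Rightarrow> bool" where
  "labeled_tree T l \<longleftrightarrow> unrooted_tree T \<and> (\<forall>v\<in>pverts T. 0 \<le> l v)"

definition joining_path :: "'a pair_pre_digraph \<Rightarrow> 'a \<Rightarrow> 'a \<Rightarrow> 'a vwalk" where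
  "joining_path T u v = (THE p. vpath p (with_proj T) \<and> hd p = u \<and> last p = v)"

definition tree_dist :: "'a pair_pre_digraph \<Rightarrow> ('a \<Rightarrow> real) \<Rightarrow> 'a \<Rightarrow> 'a \<Rightarrow> real" where
  "tree_dist T l u v = (if u = v then 0 else Max (l ` set (joining_path T u v)))"


section \<open>Diametrical graphs\<close>

definition diametrical_graph :: "('a \<Rightarrow> 'a \<Rightarrow> real) \<Rightarrow> 'a set \<Rightarrow> 'a pair_pre_digraph" where
  "diametrical_graph d A =
     \<lparr> pverts = A, parcs = {(u, v). u \<in> A \<and> v \<in> A \<and> d u v = diam d A} \<rparr>"

definition complete_multipartite :: "'a pair_pre_digraph \<Rightarrow> 'a set set \<Rightarrow> bool" where
  "complete_multipartite G P \<longleftrightarrow>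
     partition_on (pverts G) P \<and> 2 \<le> card P \<and>
     parcs G = {(u, v). \<exists>B\<in>P. \<exists>C\<in>P. B \<noteq> C \<and> u \<in> B \<and> v \<in> C}"

lemma complete_multipartite_part_eq:
  assumes "complete_multipartite G P" "B \<in> P" "u \<in> B"
  shows "B = {v \<in> pverts G. (u, v) \<notin> parcs G}"
proof -
  have U: "\<Union>P = pverts G"
    and dis: "\<And>C. C \<in> P \<Longrightarrow> C \<noteq> B \<Longrightarrow> C \<inter> B = {}"
    and E: "\<And>v. (u, v) \<in> parcs G \<longleftrightarrow> (\<exists>B\<in>P. \<exists>C\<in>P. B \<noteq> C \<and> u \<in> B \<and> v \<in> C)"
    using assms by (auto simp: complete_multipartite_def partition_on_def dest: disjointD)
  have "(u, v) \<in> parcs G \<longleftrightarrow> v \<in> pverts G \<and> v \<notin> B" for v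
    unfolding E U[symmetric] using dis assms(2,3) by blast
  moreover have "B \<subseteq> pverts G" using U assms(2) by blast
  ultimately show ?thesis by blast
qed

lemma complete_multipartite_unique:
  assumes "complete_multipartite G P" "complete_multipartite G Q"
  shows "P = Q"
proof -
  have "P \<subseteq> Q" if P: "complete_multipartite G P" and Q: "complete_multipartite G Q" for P Q
  proof
    fix B assume B: "B \<in> P"
    moreover have "B \<noteq> {}"
      using P B by (auto simp: complete_multipartite_def partition_on_def)
    ultimately obtain u where u: "u \<in> B" "u \<in> \<Union>P" by blast
    moreover have "\<Union>P = \<Union>Q"
      using P Q by (simp add: complete_multipartite_def partition_on_def)
    ultimately obtain C where C: "C \<in> Q" "u \<in> C" by blast
    then show "B \<in> Q"
      using complete_multipartite_part_eq[OF P B u(1)] complete_multipartite_part_eq[OF Q C] by simp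
  qed
  then show ?thesis using assms by blast
qed

lemma diametrical_graph_complete_multipartite:
  assumes "ultrametric_space A d" "finite A" "2 \<le> card A"
  shows "\<exists>P. complete_multipartite (diametrical_graph d A) P"
proof -
  let ?D = "{d x y | x y. x \<in> A \<and> y \<in> A}"
  have D_eq: "?D = (\<lambda>(x, y). d x y) ` (A \<times> A)" by auto
  have fin: "finite ?D" unfolding D_eq using assms(2) by blast
  have le: "d x y \<le> diam d A" if "x \<in> A" "y \<in> A" for x y
    unfolding diam_def using that fin by (intro Max_ge) auto
  have um: "d x x = 0" "d x y = d y x" "d x z \<le> max (d x y) (d y z)" "x \<noteq> y \<Longrightarrow> 0 < d x y"
    if "x \<in> A" "y \<in> A" "z \<in> A" for x y z
    using assms(1) that unfolding ultrametric_space_iff by (auto simp: less_le)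
  obtain a b where ab: "a \<in> A" "b \<in> A" "a \<noteq> b"
    using assms(3) by (metis card_le_Suc0_iff_eq assms(2) not_less_eq_eq numeral_2_eq_2)
  have pos: "0 < diam d A" using le[OF ab(1,2)] um(4)[of a b a] ab by simp
  have "diam d A \<in> ?D"
    unfolding diam_def using ab fin by (intro Max_in) auto
  then obtain p q where pq: "p \<in> A" "q \<in> A" "d p q = diam d A" by auto
  define r where "r = {(x, y). x \<in> A \<and> y \<in> A \<and> d x y < diam d A}"
  have equiv: "equiv A r"
  proof (rule equivI)
    show "r \<subseteq> A \<times> A" by (auto simp: r_def)
    show "refl_on A r" using um pos by (auto simp: refl_on_def r_def)
    show "sym r" using um by (auto simp: sym_def r_def)
    show "trans r"
    proof (rule transI)
      fix x y z assume "(x, y) \<in> r" "(y, z) \<in> r"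
      then show "(x, z) \<in> r" using um(3)[of x y z] by (auto simp: r_def)
    qed
  qed
  let ?P = "A // r"
  have "partition_on A ?P" by (rule partition_on_quotient[OF equiv])
  moreover have "2 \<le> card ?P"
  proof -
    have "r `` {p} \<noteq> r `` {q}"
    proof
      assume "r `` {p} = r `` {q}"
      then have "(p, q) \<in> r" by (rule eq_equiv_class[OF _ equiv pq(2)])
      with pq show False by (simp add: r_def)
    qed
    moreover have "finite ?P" using assms(2) equiv by (simp add: finite_quotient equiv_def)
    moreover have "{r `` {p}, r `` {q}} \<subseteq> ?P" using pq by (auto intro: quotientI)
    ultimately show ?thesis by (metis card_2_iff card_mono)
  qed
  moreover have "{(u, v). u \<in> A \<and> v \<in> A \<and> d u v = diam d A} =
      {(u, v). \<exists>B\<in>?P. \<exists>C\<in>?P. B \<noteq> C \<and> u \<in> B \<and> v \<in> C}" (is "?L = ?R")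
  proof (rule set_eqI, clarify)
    fix u v
    have "(\<exists>B\<in>?P. \<exists>C\<in>?P. B \<noteq> C \<and> u \<in> B \<and> v \<in> C) \<longleftrightarrow> u \<in> A \<and> v \<in> A \<and> (u, v) \<notin> r"
    proof
      assume "\<exists>B\<in>?P. \<exists>C\<in>?P. B \<noteq> C \<and> u \<in> B \<and> v \<in> C"
      then obtain B C where BC: "B \<in> ?P" "C \<in> ?P" "B \<noteq> C" "u \<in> B" "v \<in> C" by blast
      then have "u \<in> A" "v \<in> A" using Union_quotient[OF equiv] by auto
      moreover have "(u, v) \<notin> r" using BC quotient_eqI[OF equiv] by blast
      ultimately show "u \<in> A \<and> v \<in> A \<and> (u, v) \<notin> r" by blast
    next
      assume uv: "u \<in> A \<and> v \<in> A \<and> (u, v) \<notin> r"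
      then have "r `` {u} \<noteq> r `` {v}" using eq_equiv_class[OF _ equiv] by blast
      moreover have "r `` {u} \<in> ?P" "r `` {v} \<in> ?P" "u \<in> r `` {u}" "v \<in> r `` {v}"
        using uv equiv_class_self[OF equiv] by (auto intro: quotientI)
      ultimately show "\<exists>B\<in>?P. \<exists>C\<in>?P. B \<noteq> C \<and> u \<in> B \<and> v \<in> C"
        by (intro bexI[of _ "r `` {u}"] bexI[of _ "r `` {v}"] conjI)
    qed
    moreover have "(u, v) \<notin> r \<longleftrightarrow> d u v = diam d A" if "u \<in> A" "v \<in> A"
      using le[OF that] that by (auto simp: r_def)
    ultimately show "(u, v) \<in> ?L \<longleftrightarrow> (u, v) \<in> ?R" by auto
  qed
  ultimately show ?thesis
    by (intro exI[of _ ?P]) (simp add: complete_multipartite_def diametrical_graph_def)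
qed


section \<open>Representing trees\<close>

text \<open>The arcs of a rooted tree point from a node to its direct successors.\<close>

record 'v rooted_labeled_tree = "'v pair_pre_digraph" +
  rt_root :: 'v
  rt_label :: "'v \<Rightarrow> real"

definition leaf :: "('v, 'b) pair_pre_digraph_scheme \<Rightarrow> 'v \<Rightarrow> bool" where
  "leaf R v \<longleftrightarrow> v \<in> pverts R \<and> (\<nexists>w. (v, w) \<in> parcs R)"

definition inner_node :: "('v, 'b) pair_pre_digraph_scheme \<Rightarrow> 'v \<Rightarrow> bool" where
  "inner_node R v \<longleftrightarrow> v \<in> pverts R \<and> \<not> leaf R v"

definition rep_child :: "('a \<Rightarrow> 'a \<Rightarrow> real) \<Rightarrow> 'a set \<Rightarrow> 'a set \<Rightarrow> bool" where
  "rep_child d A B \<longleftrightarrow>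
     2 \<le> card A \<and> (\<exists>P. complete_multipartite (diametrical_graph d A) P \<and> B \<in> P)"

inductive_set rep_nodes :: "('a \<Rightarrow> 'a \<Rightarrow> real) \<Rightarrow> 'a set \<Rightarrow> 'a set set"
  for d :: "'a \<Rightarrow> 'a \<Rightarrow> real" and X :: "'a set" where
  root: "X \<in> rep_nodes d X"
| child: "A \<in> rep_nodes d X \<Longrightarrow> rep_child d A B \<Longrightarrow> B \<in> rep_nodes d X"

text \<open>On a singleton \<open>{x}\<close> the label \<open>diam d {x}\<close> is \<open>d x x = 0\<close>.\<close>

definition representing_tree ::
    "'a set \<Rightarrow> ('a \<Rightarrow> 'a \<Rightarrow> real) \<Rightarrow> 'a set rooted_labeled_tree" where
  "representing_tree X d =
     \<lparr> pverts = rep_nodes d X,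
       parcs = {(A, B). A \<in> rep_nodes d X \<and> rep_child d A B},
       rt_root = X,
       rt_label = diam d \<rparr>"

definition inner_nodes_have_leaf_child :: "('v, 'b) pair_pre_digraph_scheme \<Rightarrow> bool" where
  "inner_nodes_have_leaf_child R \<longleftrightarrow>
     (\<forall>A. inner_node R A \<longrightarrow> (\<exists>B. (A, B) \<in> parcs R \<and> leaf R B))"

lemma ultrametric_space_subset:
  assumes "ultrametric_space X d" "A \<subseteq> X"
  shows "ultrametric_space A d"
proof -
  have X: "x \<in> X" if "x \<in> A" for x using that assms(2) by blast
  show ?thesis
    using assms(1) unfolding ultrametric_space_iff by (simp add: X)
qed

lemma rep_nodes_subset:
  assumes "A \<in> rep_nodes d X" "X \<noteq> {}"
  shows "A \<subseteq> X \<and> A \<noteq> {}"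
  using assms
proof (induction rule: rep_nodes.induct)
  case (child A B)
  from child.hyps(2) obtain P where P: "B \<in> P" "\<Union>P = A" "{} \<notin> P"
    by (auto simp: rep_child_def complete_multipartite_def diametrical_graph_def partition_on_def)
  then have "B \<subseteq> A" "B \<noteq> {}" by blast+
  then show ?case using child.IH[OF child.prems] by blast
qed simp

lemma leaf_representing_tree_iff:
  assumes "ultrametric_space X d" "finite X" "X \<noteq> {}" "A \<in> rep_nodes d X"
  shows "leaf (representing_tree X d) A \<longleftrightarrow> (\<exists>x. A = {x})"
proof -
  have A: "A \<subseteq> X" "A \<noteq> {}" "finite A"
    using rep_nodes_subset[OF assms(4,3)] assms(2) finite_subset by auto
  have "leaf (representing_tree X d) A \<longleftrightarrow> (\<nexists>B. rep_child d A B)"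
    using assms(4) by (simp add: leaf_def representing_tree_def)
  also have "\<dots> \<longleftrightarrow> \<not> 2 \<le> card A"
  proof -
    have "\<exists>B. rep_child d A B" if c: "2 \<le> card A"
    proof -
      obtain P where P: "complete_multipartite (diametrical_graph d A) P"
        using diametrical_graph_complete_multipartite[OF
            ultrametric_space_subset[OF assms(1) A(1)] A(3) c] by blast
      then have "P \<noteq> {}" by (auto simp: complete_multipartite_def)
      with P c show ?thesis by (auto simp: rep_child_def)
    qed
    then show ?thesis by (auto simp: rep_child_def)
  qed
  also have "\<dots> \<longleftrightarrow> card A = 1"
  proof -
    have "card A \<noteq> 0" using A by simp
    then show ?thesis by linarith
  qed
  also have "\<dots> \<longleftrightarrow> (\<exists>x. A = {x})" by (simp add: card_1_singleton_iff)
  finally show ?thesis .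
qed

end

(*
  Both directions pass through one property of a finite ultrametric space: every distance
  d x y > 0 is the distance from some point w, with d x w <= d x y, to its nearest neighbour.
  It holds iff every inner node of the representing tree has a leaf child, because the points
  outside a node A are at distance > diam A from those of A. In a labeled tree, a vertex w of
  largest label on the path from x to y is such a point. Conversely, with l x the distance from
  x to its nearest neighbour, the tree is built by attaching leaves.
*)

theory Submission
  imports Defs
begin

section \<open>Paths in unrooted trees\<close>

text \<open>This is the predicate under the definite description in \<open>joining_path\<close>; it
  allows reasoning about paths before their uniqueness is known.\<close>

definition joins :: "'a pair_pre_digraph \<Rightarrow> 'a \<Rightarrow> 'a \<Rightarrow> 'a vwalk \<Rightarrow> bool" where
  "joins T u v p \<longleftrightarrow> vpath p (with_proj T) \<and> hd p = u \<and> last p = v"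

lemma joinsD:
  assumes "joins T u v p"
  shows "p \<noteq> []" "distinct p" "set p \<subseteq> pverts T" "u \<in> set p" "v \<in> set p"
  using assms by (auto simp: joins_def vpath_def vwalk_def)

text \<open>\<open>cycle\<close> speaks of lists of arcs, paths here are lists of vertices. This
  lemma and the next two translate between them.\<close>

lemma pcas_vwalk_arcs: "p \<noteq> [] \<Longrightarrow> pcas (hd p) (vwalk_arcs p) (last p)"
  by (induction p rule: vwalk_arcs.induct) auto

lemma pawalk_verts_vwalk_arcs: "p \<noteq> [] \<Longrightarrow> pawalk_verts (hd p) (vwalk_arcs p) = p"
  by (induction p rule: vwalk_arcs.induct) auto

lemma length_vwalk_arcs: "length (vwalk_arcs p) = length p - 1"
  by (induction p rule: vwalk_arcs.induct) auto

lemma joins_Cons: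
  assumes "joins T u v (x # p)" "p \<noteq> []"
  shows "x = u" "x \<notin> set p" "(x, hd p) \<in> parcs T" "joins T (hd p) v p"
  using assms by (auto simp: joins_def vpath_def elim: vwalk_consE)

lemma joins_rev:
  assumes "symmetric (with_proj T)" "joins T u v p"
  shows "joins T v u (rev p)"
  using assms vwalk_rev_ex[OF assms(1), of p]
  by (auto simp: joins_def vpath_def hd_rev last_rev)

lemma joins_prefix:
  assumes "joins T u v (xs @ w # ys)"
  shows "joins T u w (xs @ [w])"
  using assms vwalkI_append_l[of "xs @ [w]" ys]
  by (auto simp: joins_def vpath_def hd_append split: if_splits)

context pair_bidirected_digraph
begin

lemma cycle_vwalk_arcs:
  assumes "vwalk p (with_proj G)" "hd p = last p" "distinct (tl p)" "2 \<le> length p"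
  shows "cycle (vwalk_arcs p)"
proof -
  have ne: "p \<noteq> []" using assms by auto
  have "awalk (hd p) (vwalk_arcs p) (hd p)"
    using assms pcas_vwalk_arcs[OF ne] ne by (auto simp: awalk_def vwalk_def)
  moreover have "vwalk_arcs p \<noteq> []"
    using assms(4) length_vwalk_arcs[of p] by auto
  ultimately show ?thesis
    unfolding cycle_def using assms(3) pawalk_verts_vwalk_arcs[OF ne] by auto
qed

text \<open>
  At the first vertex \<open>x\<close> where two paths part, the rests of both paths form a walk between
  two distinct neighbours of \<open>x\<close> that avoids \<open>x\<close>; shortened to a path, it closes to a cycle.
\<close>

lemma joins_unique:
  assumes acyclic: "\<nexists>c. cycle c \<and> 3 \<le> length c"
    and "joins G u v p" "joins G u v q"
  shows "p = q"
  using assms(2,3)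
proof (induction p arbitrary: u q)
  case Nil
  then show ?case by (simp add: joins_def vpath_def vwalk_def)
next
  case (Cons x p)
  obtain q' where q: "q = x # q'"
    using Cons.prems by (cases q) (auto simp: joins_def vpath_def vwalk_def)
  show ?case
  proof (cases "p = [] \<or> q' = []")
    case True
    \<comment> \<open>One of the paths stops at \<open>x\<close>, so \<open>v = x\<close>. A
      nonempty tail of the other path would have \<open>x\<close> as its last entry, against
      distinctness.\<close>
    have "x \<notin> set p" "x \<notin> set q'"
      using joinsD(2)[OF Cons.prems(1)] joinsD(2)[OF Cons.prems(2)] q by auto
    moreover have "last (x # p) = last (x # q')"
      using Cons.prems q by (metis joins_def)
    ultimately show ?thesis
      unfolding q using True by (metis last_ConsL last_ConsR last_in_set)
  next
    case False
    note p = joins_Cons[OF Cons.prems(1)] and q' = joins_Cons[OF Cons.prems(2)[unfolded q]]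
    show ?thesis
    proof (cases "hd p = hd q'")
      case True
      then show ?thesis using Cons.IH[of "hd p" q'] p q' False q by simp
    next
      case hd_neq: False
      define s where "s = p \<oplus> rev q'"
      have ne: "p \<noteq> []" "q' \<noteq> []" using False by auto
      have last: "last p = hd (rev q')"
        using p(4) q'(4) ne by (simp add: joins_def hd_rev)
      have "vwalk p G" "vwalk (rev q') G"
        using p(4) q'(4) ne vwalk_rev_ex[OF pair_sym_arcs] by (auto simp: joins_def vpath_def)
      then have s: "vwalk s G"
        unfolding s_def using last by (rule vwalk_joinI_vwalk')
      have s_ends: "hd s = hd p" "last s = hd q'"
        unfolding s_def using last ne
        by (simp_all add: vwalk_join_hd' vwalk_join_last last_rev)
      have "set s \<subseteq> set p \<union> set q'"
        unfolding s_def vwalk_join_def by (cases "rev q'") (auto simp flip: set_rev[of q'])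
      then have x_s: "x \<notin> set s" using p(2) q'(2) ne by blast
      define r where "r = vwalk_to_vpath s"
      have r: "vwalk r G" "distinct r" "hd r = hd p" "last r = hd q'" "r \<noteq> []" "x \<notin> set r"
        using vwalk_to_vpath_vpath[OF s] s_ends x_s
        by (auto simp: r_def vpath_def vwalk_to_vpath_hd vwalk_to_vpath_last vwalk_def
            dest: vwalk_to_vpath_subset)
      \<comment> \<open>The ends of \<open>r\<close> differ, so \<open>r\<close> has at least two
        vertices, and the closed walk through \<open>x\<close> has \<open>length r + 1\<close>,
        hence at least three, arcs.\<close>
      have "2 \<le> length r"
        using r(3-5) hd_neq by (cases r) (auto simp: Suc_le_eq)
      moreover have "vwalk (x # r @ [x]) G"
      proof -
        have "vwalk [hd q', x] G"
          using q'(3) ne arcs_symmetric[of x "hd q'"] by (auto simp: wellformed')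
        then have "vwalk (r \<oplus> [hd q', x]) G"
          using r(1,4) by (intro vwalk_joinI_vwalk') auto
        then have "vwalk (r @ [x]) G" by (simp add: vwalk_join_def)
        then show ?thesis
          using p(3) ne r(3,5) by (intro vwalk_wf_digraph_consI) auto
      qed
      then have "cycle (vwalk_arcs (x # r @ [x]))"
        using r by (intro cycle_vwalk_arcs) auto
      ultimately show ?thesis
        using acyclic length_vwalk_arcs[of "x # r @ [x]"] by force
    qed
  qed
qed

text \<open>Connectedness is strong connectedness of the symmetric closure. Here that closure adds
  nothing to reachability, and every reachable vertex is reached by a path.\<close>

lemma connected_iff_joins:
  "Digraph_Component.connected (with_proj G) \<longleftrightarrow>
     pverts G \<noteq> {} \<and> (\<forall>u\<in>pverts G. \<forall>v\<in>pverts G. \<exists>p. joins G u v p)"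
  unfolding connected_def strongly_connected_def joins_def
  using reachable_mk_symmetric_eq[OF pair_sym_arcs] reachable_vpath_conv
  by simp

end

text \<open>With trees characterised by unique paths, attaching a leaf can be verified on paths,
  without handling cycles.\<close>

lemma unrooted_tree_iff:
  "unrooted_tree T \<longleftrightarrow> pair_bidirected_digraph T \<and> pverts T \<noteq> {} \<and>
     (\<forall>u\<in>pverts T. \<forall>v\<in>pverts T. \<exists>!p. joins T u v p)"
  (is "_ \<longleftrightarrow> ?B \<and> ?N \<and> ?U")
proof
  assume T: "unrooted_tree T"
  then interpret pair_bidirected_digraph T by (simp add: unrooted_tree_def)
  show "?B \<and> ?N \<and> ?U"
    using T joins_unique pair_bidirected_digraph_axioms
    unfolding unrooted_tree_def connected_iff_joins by blast
next
  assume A: "?B \<and> ?N \<and> ?U"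
  then interpret pair_bidirected_digraph T by simp
  have "\<not> 3 \<le> length c" if c: "cycle c" for c
  proof
    assume len: "3 \<le> length c"
    from c obtain u where u: "awalk u c u" "distinct (tl (awalk_verts u c))"
      by (auto simp: cycle_def)
    obtain a e c' where c': "c = (u, a) # e # c'"
      using u(1) len by (cases c; cases "tl c") (auto simp: awalk_simps)
    \<comment> \<open>Without its first vertex \<open>u\<close>, the cycle is a path from
      \<open>a\<close> round to \<open>u\<close>. It has as many vertices as \<open>c\<close> has
      arcs, so at least three, and thus differs from the path \<open>[a, u]\<close> along a single
      arc.\<close>
    define q where "q = tl (awalk_verts u c)"
    have q: "q = awalk_verts a (e # c')" by (simp add: q_def c')
    have walk: "awalk a (e # c') u" "(u, a) \<in> parcs T"
      using u(1) c' by (auto simp: awalk_Cons_iff)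
    have "hd q = a" "last q = u"
      using walk(1) unfolding q by (auto elim: awalkE)
    then have "joins T a u q"
      using awalk_imp_vwalk[OF walk(1)] u(2) unfolding q[symmetric]
      by (auto simp: joins_def vpath_def q_def)
    moreover have "joins T a u [a, u]"
      using walk(2) arcs_symmetric[of u a] pair_no_loops[of "(u, a)"]
      by (auto simp: joins_def vpath_def wellformed')
    ultimately have "q = [a, u]" using A walk(2) wellformed' by blast
    moreover have "length q = length c" by (simp add: q_def length_awalk_verts)
    ultimately show False using len by simp
  qed
  then show "unrooted_tree T"
    using A connected_iff_joins unfolding unrooted_tree_def by blast
qed

lemma joining_path_eq:
  assumes "unrooted_tree T" "joins T u v p"
  shows "joining_path T u v = p"
proof -
  have "u \<in> pverts T" "v \<in> pverts T" using joinsD[OF assms(2)] by auto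
  then have "\<exists>!p. joins T u v p" using assms(1) by (simp add: unrooted_tree_iff)
  then show ?thesis
    unfolding joining_path_def using assms(2) by (intro the_equality) (auto simp: joins_def)
qed

lemma joins_joining_path:
  assumes "unrooted_tree T" "u \<in> pverts T" "v \<in> pverts T"
  shows "joins T u v (joining_path T u v)"
proof -
  obtain p where "joins T u v p" using assms unfolding unrooted_tree_iff by meson
  with joining_path_eq[OF assms(1) this] show ?thesis by simp
qed

lemma unrooted_tree_symmetric: "unrooted_tree T \<Longrightarrow> symmetric (with_proj T)"
  unfolding unrooted_tree_def pair_bidirected_digraph_def
  using pair_sym_digraph.pair_sym_arcs by blast

lemma tree_dist_commute:
  assumes "unrooted_tree T" "u \<in> pverts T" "v \<in> pverts T"
  shows "tree_dist T l u v = tree_dist T l v u"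
  using joining_path_eq[OF assms(1)
      joins_rev[OF unrooted_tree_symmetric[OF assms(1)] joins_joining_path[OF assms]]]
  by (simp add: tree_dist_def)

section \<open>The one-vertex tree and the attachment of leaves\<close>

lemma unrooted_tree_singleton: "unrooted_tree \<lparr>pverts = {x}, parcs = {}\<rparr>"
proof -
  let ?T = "\<lparr>pverts = {x}, parcs = {}\<rparr>"
  have "joins ?T x x p \<longleftrightarrow> p = [x]" for p
    by (cases p rule: vwalk_arcs.cases) (auto simp: joins_def vpath_def vwalk_def)
  moreover have "pair_bidirected_digraph ?T"
    by unfold_locales (auto simp: symmetric_def sym_def)
  ultimately show ?thesis unfolding unrooted_tree_iff Ex1_def by simp
qed

definition add_leaf :: "'a pair_pre_digraph \<Rightarrow> 'a \<Rightarrow> 'a \<Rightarrow> 'a pair_pre_digraph" where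
  "add_leaf T w y = \<lparr>pverts = insert y (pverts T), parcs = parcs T \<union> {(y, w), (w, y)}\<rparr>"

context
  fixes T :: "'a pair_pre_digraph" and w y :: 'a
  assumes tree: "unrooted_tree T" and w: "w \<in> pverts T" and y: "y \<notin> pverts T"
begin

interpretation T: pair_bidirected_digraph T
  using tree by (simp add: unrooted_tree_def)

lemma add_leaf_simps [simp]:
  "pverts (add_leaf T w y) = insert y (pverts T)"
  "parcs (add_leaf T w y) = parcs T \<union> {(y, w), (w, y)}"
  by (simp_all add: add_leaf_def)

interpretation L: pair_bidirected_digraph "add_leaf T w y"
proof
  show "symmetric (with_proj (add_leaf T w y))"
    using T.arcs_symmetric by (auto simp: symmetric_def intro!: symI)
qed (use w y T.no_loops T.wellformed' in auto)

lemma joins_add_leaf_mono: "joins T u v p \<Longrightarrow> joins (add_leaf T w y) u v p"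
  by (auto simp: joins_def vpath_def vwalk_def)

text \<open>The only neighbour of \<open>y\<close> is \<open>w\<close>, so a path passing through
  \<open>y\<close> would visit \<open>w\<close> both before and after it.\<close>

lemma joins_add_leaf_avoids:
  assumes p: "joins (add_leaf T w y) u v p" and "u \<noteq> y" "v \<noteq> y"
  shows "y \<notin> set p"
proof
  assume "y \<in> set p"
  then obtain xs ys where split: "p = xs @ y # ys" by (auto simp: in_set_conv_decomp)
  then have "xs \<noteq> []" "ys \<noteq> []" using assms by (auto simp: joins_def)
  then obtain xs' a b ys' where "xs = xs' @ [a]" "ys = b # ys'"
    by (metis list.exhaust rev_exhaust)
  then have p': "p = xs' @ [a, y, b] @ ys'" using split by simp
  have "set (vwalk_arcs p) \<subseteq> parcs (add_leaf T w y)"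
    using p by (simp add: joins_def vpath_def vwalk_def)
  moreover have "set (vwalk_arcs ([a, y, b])) \<subseteq> set (vwalk_arcs p)"
    unfolding p' using set_vwalk_arcs_append1 set_vwalk_arcs_append2 by blast
  ultimately have "(a, y) \<in> parcs (add_leaf T w y)" "(y, b) \<in> parcs (add_leaf T w y)"
    by auto
  then have "a = w" "b = w" using y w T.wellformed' by auto
  then show False using joinsD(2)[OF p] p' by simp
qed

lemma joins_add_leafD:
  assumes p: "joins (add_leaf T w y) u v p" and "y \<notin> set p"
  shows "joins T u v p"
proof -
  have "set (vwalk_arcs p) \<subseteq> parcs T"
  proof
    fix e assume e: "e \<in> set (vwalk_arcs p)"
    moreover have "e \<in> parcs (add_leaf T w y)"
      using e p by (auto simp: joins_def vpath_def vwalk_def)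
    ultimately show "e \<in> parcs T"
      using assms(2) arcs_in_vwalk_arcs[OF e] by auto
  qed
  then show ?thesis
    using p assms(2) by (auto simp: joins_def vpath_def vwalk_def)
qed

lemma joins_add_leaf_Cons:
  assumes "joins T w v p"
  shows "joins (add_leaf T w y) y v (y # p)"
proof -
  have "vwalk (y # p) (add_leaf T w y)"
    using joins_add_leaf_mono[OF assms] assms
    by (intro vwalk_consI) (simp_all add: joins_def vpath_def)
  then show ?thesis
    using joinsD[OF assms] y assms by (auto simp: joins_def vpath_def)
qed

text \<open>A nontrivial path from \<open>y\<close> must step to \<open>w\<close> and then stay in
  \<open>T\<close>; a path to \<open>y\<close> is the reverse of such a path; any other path lies in
  \<open>T\<close> altogether. Uniqueness is thus inherited from \<open>T\<close>.\<close>

lemma joins_add_leaf_unique: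
  assumes p: "joins (add_leaf T w y) u v p" and q: "joins (add_leaf T w y) u v q"
  shows "p = q"
proof -
  have T_eq: "p = q" if "joins T u v p" "joins T u v q" for u v p q
    using joining_path_eq[OF tree] that by metis
  have from_y: "p = (if v = y then [y] else y # joining_path T w v)"
    if p: "joins (add_leaf T w y) y v p" for v p
  proof -
    obtain p' where p': "p = y # p'"
      using p joinsD(1)[OF p] by (cases p) (auto simp: joins_def)
    show ?thesis
    proof (cases "p' = []")
      case True
      then show ?thesis using p p' by (auto simp: joins_def)
    next
      case False
      note c = joins_Cons[OF p[unfolded p'] False]
      have "hd p' = w" using c(2,3) w y False T.wellformed' by auto
      then have "joins T w v p'" using joins_add_leafD[OF c(4) c(2)] by simp
      moreover from this have "v \<noteq> y" using joinsD[of T w v p'] y by auto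
      ultimately show ?thesis using joining_path_eq[OF tree] p' by simp
    qed
  qed
  consider "u = y" | "v = y" | "u \<noteq> y" "v \<noteq> y" by blast
  then show ?thesis
  proof cases
    case 1
    then show ?thesis using from_y p q by metis
  next
    case 2
    then have "rev p = rev q"
      using from_y joins_rev[OF L.pair_sym_arcs p] joins_rev[OF L.pair_sym_arcs q] by metis
    then show ?thesis by simp
  next
    case 3
    then show ?thesis
      using p q joins_add_leaf_avoids joins_add_leafD T_eq by metis
  qed
qed

lemma unrooted_tree_add_leaf: "unrooted_tree (add_leaf T w y)"
proof -
  have T_ex: "\<exists>p. joins T u v p" if "u \<in> pverts T" "v \<in> pverts T" for u v
    using joins_joining_path[OF tree that] by blast
  have from_y: "\<exists>p. joins (add_leaf T w y) y v p" if "v \<in> insert y (pverts T)" for v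
  proof (cases "v = y")
    case True
    then have "joins (add_leaf T w y) y v [y]" by (auto simp: joins_def vpath_def)
    then show ?thesis ..
  next
    case False
    then show ?thesis using T_ex[OF w] that joins_add_leaf_Cons by blast
  qed
  have "\<exists>p. joins (add_leaf T w y) u v p"
    if "u \<in> insert y (pverts T)" "v \<in> insert y (pverts T)" for u v
  proof (cases "u \<in> pverts T \<and> v \<in> pverts T")
    case True
    then show ?thesis using T_ex joins_add_leaf_mono by blast
  next
    case False
    then show ?thesis
      using that from_y joins_rev[OF L.pair_sym_arcs] by blast
  qed
  then show ?thesis
    unfolding unrooted_tree_iff
    using L.pair_bidirected_digraph_axioms joins_add_leaf_unique by auto
qed

lemma tree_dist_add_leaf:
  assumes "u \<in> pverts T" "v \<in> pverts T"
  shows "tree_dist (add_leaf T w y) l u v = tree_dist T l u v"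
  using joining_path_eq[OF unrooted_tree_add_leaf
      joins_add_leaf_mono[OF joins_joining_path[OF tree assms]]]
  by (simp add: tree_dist_def)

text \<open>The new path is the old one from \<open>w\<close> with \<open>y\<close> in front. The
  case \<open>v = w\<close> is separate because \<open>tree_dist T l w w\<close> is 0, while the
  path \<open>[w]\<close> contributes the label \<open>l w\<close>.\<close>

lemma tree_dist_leaf:
  assumes "v \<in> pverts T"
  shows "tree_dist (add_leaf T w y) l y v =
    (if v = w then max (l y) (l w) else max (l y) (tree_dist T l w v))"
proof -
  note p = joins_joining_path[OF tree w assms]
  have "joining_path (add_leaf T w y) y v = y # joining_path T w v"
    by (rule joining_path_eq[OF unrooted_tree_add_leaf joins_add_leaf_Cons[OF p]])
  moreover have "joining_path T w w = [w]"
    using w by (intro joining_path_eq[OF tree]) (auto simp: joins_def vpath_def)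
  moreover have "y \<noteq> v" using assms y by auto
  ultimately show ?thesis using joinsD(1)[OF p] by (auto simp: tree_dist_def)
qed

end


section \<open>Representing trees and isolated points\<close>

lemma diam_ge:
  assumes "finite A" "x \<in> A" "y \<in> A"
  shows "d x y \<le> diam d A"
proof -
  have "{d x y | x y. x \<in> A \<and> y \<in> A} = (\<lambda>(x, y). d x y) ` (A \<times> A)" by auto
  then have "finite {d x y | x y. x \<in> A \<and> y \<in> A}" using assms(1) by simp
  then show ?thesis unfolding diam_def using assms(2,3) by (intro Max_ge) auto
qed

lemma diam_attained:
  assumes "finite A" "A \<noteq> {}"
  obtains x y where "x \<in> A" "y \<in> A" "d x y = diam d A"
proof -
  have "{d x y | x y. x \<in> A \<and> y \<in> A} = (\<lambda>(x, y). d x y) ` (A \<times> A)" by auto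
  then have "diam d A \<in> {d x y | x y. x \<in> A \<and> y \<in> A}"
    unfolding diam_def using assms by (intro Max_in) auto
  then show ?thesis using that by auto
qed

text \<open>A part of a complete multipartite graph consists of the non-neighbours of any one of its
  points. As distances in \<open>A\<close> are at most \<open>diam d A\<close>, a child is the open
  ball in \<open>A\<close> of radius \<open>diam d A\<close> about each of its points.\<close>

lemma rep_child_eq:
  assumes "rep_child d A B" "u \<in> B"
  shows "B = {v \<in> A. d u v \<noteq> diam d A}" "u \<in> A"
proof -
  obtain P where P: "complete_multipartite (diametrical_graph d A) P" "B \<in> P"
    using assms(1) by (auto simp: rep_child_def)
  then have B: "B = {v \<in> A. (u, v) \<notin> parcs (diametrical_graph d A)}"
    using complete_multipartite_part_eq[OF P assms(2)] by (simp add: diametrical_graph_def)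
  then show "u \<in> A" using assms(2) by auto
  then show "B = {v \<in> A. d u v \<noteq> diam d A}"
    using B by (auto simp: diametrical_graph_def)
qed

lemma rep_child_exists:
  assumes "ultrametric_space A d" "finite A" "2 \<le> card A" "u \<in> A"
  shows "rep_child d A {v \<in> A. d u v \<noteq> diam d A}"
proof -
  obtain P where P: "complete_multipartite (diametrical_graph d A) P"
    using diametrical_graph_complete_multipartite[OF assms(1-3)] by blast
  then have "\<Union>P = A"
    by (simp add: complete_multipartite_def partition_on_def diametrical_graph_def)
  then obtain B where B: "B \<in> P" "u \<in> B" using assms(4) by blast
  then have "rep_child d A B" using P assms(3) by (auto simp: rep_child_def)
  with rep_child_eq(1)[OF this B(2)] show ?thesis by simp
qed

section \<open>Distances inside and across the nodes of a representing tree\<close>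

context
  fixes X :: "'a set" and d :: "'a \<Rightarrow> 'a \<Rightarrow> real"
  assumes um: "ultrametric_space X d" and fin: "finite X" and ne: "X \<noteq> {}"
begin

lemma um_simps:
  assumes "x \<in> X" "y \<in> X"
  shows "0 \<le> d x y" "d x y = 0 \<longleftrightarrow> x = y" "d x y = d y x"
  using um assms unfolding ultrametric_space_iff by simp_all

lemma um_pos: "x \<in> X \<Longrightarrow> y \<in> X \<Longrightarrow> x \<noteq> y \<Longrightarrow> 0 < d x y"
  using um_simps(1,2)[of x y] by simp

lemma um_max: "x \<in> X \<Longrightarrow> y \<in> X \<Longrightarrow> z \<in> X \<Longrightarrow> d x z \<le> max (d x y) (d y z)"
  using um unfolding ultrametric_space_iff by simp

lemma rep_node:
  assumes "A \<in> rep_nodes d X"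
  shows "A \<subseteq> X" "A \<noteq> {}" "finite A"
  using rep_nodes_subset[OF assms ne] fin finite_subset by auto

text \<open>If \<open>p\<close> and \<open>q\<close> realise the diameter, the ultrametric
  inequality through \<open>u\<close> forces \<open>d u p\<close> or \<open>d u q\<close> to be the
  diameter as well.\<close>

lemma diam_from_point:
  assumes A: "A \<subseteq> X" "u \<in> A"
  obtains v where "v \<in> A" "d u v = diam d A"
proof -
  have "finite A" "A \<noteq> {}" using A fin finite_subset by auto
  then obtain p q where pq: "p \<in> A" "q \<in> A" "d p q = diam d A" by (rule diam_attained)
  have "d u p \<le> diam d A" "d u q \<le> diam d A"
    using diam_ge[OF \<open>finite A\<close>] A pq by auto
  moreover have "d p q \<le> max (d u p) (d u q)"
    using um_max[of p u q] um_simps(3)[of p u] A pq by auto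
  ultimately have "d u p = diam d A \<or> d u q = diam d A" using pq(3) by linarith
  then show thesis using that pq by blast
qed

text \<open>Induction downwards from the root. From a node \<open>A\<close> to its child
  \<open>B\<close> the diameter drops strictly, since \<open>x\<close> attains
  \<open>diam d B\<close> within \<open>B\<close>, where its distances are not
  \<open>diam d A\<close>. A point of \<open>A\<close> outside \<open>B\<close> is at distance
  exactly \<open>diam d A\<close> from \<open>x\<close>; a point outside \<open>A\<close> is farther
  by induction.\<close>

lemma diam_less_dist_outside:
  assumes "A \<in> rep_nodes d X" "x \<in> A" "z \<in> X - A"
  shows "diam d A < d x z"
  using assms
proof (induction arbitrary: x rule: rep_nodes.induct)
  case root
  then show ?case by simp
next
  case (child A B)
  note B = rep_child_eq[OF child.hyps(2) child.prems(1)]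
  have A: "A \<subseteq> X" "finite A" using rep_node[OF child.hyps(1)] by auto
  have "B \<subseteq> X" using A B by blast
  then obtain v where v: "v \<in> B" "d x v = diam d B"
    using child.prems(1) by (rule diam_from_point)
  have "v \<in> A" "d x v \<noteq> diam d A" using B(1) v(1) by blast+
  then have "diam d B < diam d A"
    using diam_ge[OF A(2) B(2) \<open>v \<in> A\<close>, of d] v by linarith
  moreover have "diam d A \<le> d x z"
  proof (cases "z \<in> A")
    case True
    have "z \<notin> B" using child.prems(2) by simp
    then show ?thesis using True B(1) by auto
  next
    case False
    then have "diam d A < d x z" using child.IH[OF B(2)] child.prems(2) by simp
    then show ?thesis by simp
  qed
  ultimately show ?case by linarith
qed

text \<open>Descent in the tree: as long as \<open>d x y\<close> is not \<open>diam d A\<close>, the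
  child around \<open>x\<close> contains \<open>y\<close> too, and it is smaller than
  \<open>A\<close>. The general start \<open>A\<close> serves the induction; the application starts
  at the root.\<close>

lemma rep_node_of_pair:
  assumes "A \<in> rep_nodes d X" "x \<in> A" "y \<in> A" "x \<noteq> y"
  shows "\<exists>B\<in>rep_nodes d X. x \<in> B \<and> y \<in> B \<and> diam d B = d x y"
  using assms
proof (induction "card A" arbitrary: A rule: less_induct)
  case less
  note xy = \<open>x \<in> A\<close> \<open>y \<in> A\<close> \<open>x \<noteq> y\<close>
  show ?case
  proof (cases "d x y = diam d A")
    case True
    then show ?thesis using less.prems by auto
  next
    case False
    have A: "A \<subseteq> X" "finite A" using rep_node[OF less.prems(1)] by auto
    define B where "B = {v \<in> A. d x v \<noteq> diam d A}"
    have "2 \<le> card A" using A(2) xy by (metis card_le_Suc0_iff_eq not_less_eq_eq numeral_2_eq_2)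
    then have "rep_child d A B"
      unfolding B_def using xy A ultrametric_space_subset[OF um] by (intro rep_child_exists) auto
    then have "B \<in> rep_nodes d X" using less.prems(1) by (rule rep_nodes.child[rotated])
    moreover have "x \<in> B" "y \<in> B"
    proof -
      have "0 < d x y" using um_pos xy A(1) by blast
      then have "d x x \<noteq> diam d A"
        using diam_ge[OF A(2) xy(1,2), of d] um_simps(2)[of x x] xy A by auto
      then show "x \<in> B" "y \<in> B" using False xy by (auto simp: B_def)
    qed
    moreover have "B \<subset> A"
    proof -
      obtain v where "v \<in> A" "d x v = diam d A" using A(1) xy(1) by (rule diam_from_point)
      then show ?thesis by (auto simp: B_def)
    qed
    then have "card B < card A" using A(2) by (simp add: psubset_card_mono)
    ultimately show ?thesis using less.hyps xy(3) by blast
  qed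
qed

text \<open>A leaf child \<open>{w}\<close> of \<open>A\<close> means that \<open>w\<close> is at
  distance \<open>diam d A\<close> from the rest of \<open>A\<close>; points outside
  \<open>A\<close> are farther still. Pairs \<open>x\<close>, \<open>y\<close> and inner nodes
  \<open>A\<close> correspond through \<open>diam d A = d x y\<close>.\<close>

lemma inner_nodes_have_leaf_child_iff:
  "inner_nodes_have_leaf_child (representing_tree X d) \<longleftrightarrow>
     (\<forall>x\<in>X. \<forall>y\<in>X. x \<noteq> y \<longrightarrow> (\<exists>w\<in>X. d x w \<le> d x y \<and> (\<forall>z\<in>X - {w}. d x y \<le> d w z)))"
  (is "?L \<longleftrightarrow> ?R")
proof
  assume L: ?L
  show ?R
  proof (intro ballI impI)
    fix x y assume xy: "x \<in> X" "y \<in> X" "x \<noteq> y"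
    obtain A where A: "A \<in> rep_nodes d X" "x \<in> A" "y \<in> A" "diam d A = d x y"
      using rep_node_of_pair[OF rep_nodes.root xy] by blast
    have "\<not> (\<exists>x. A = {x})" using A xy by auto
    then have "inner_node (representing_tree X d) A"
      using leaf_representing_tree_iff[OF um fin ne A(1)] A(1)
      by (simp add: inner_node_def representing_tree_def)
    then obtain B where B: "rep_child d A B" "leaf (representing_tree X d) B"
      using L by (auto simp: inner_nodes_have_leaf_child_def representing_tree_def)
    then have "B \<in> rep_nodes d X" using A(1) by (blast intro: rep_nodes.child)
    then obtain w where w: "B = {w}"
      using B(2) leaf_representing_tree_iff[OF um fin ne] by blast
    then have w_A: "w \<in> A" and w_eq: "{w} = {v \<in> A. d w v \<noteq> diam d A}"
      using rep_child_eq[OF B(1), of w] by auto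
    have "d x w \<le> d x y"
      using diam_ge[OF rep_node(3)[OF A(1)] A(2) w_A, of d] A(4) by simp
    moreover have "d x y \<le> d w z" if "z \<in> X - {w}" for z
    proof (cases "z \<in> A")
      case True
      then have "d w z = diam d A" using w_eq that by blast
      then show ?thesis using A(4) by simp
    next
      case False
      then show ?thesis using diam_less_dist_outside[OF A(1) w_A, of z] that A(4) by simp
    qed
    ultimately show "\<exists>w\<in>X. d x w \<le> d x y \<and> (\<forall>z\<in>X - {w}. d x y \<le> d w z)"
      using w_A rep_node(1)[OF A(1)] by blast
  qed
next
  assume R: ?R
  show ?L
    unfolding inner_nodes_have_leaf_child_def
  proof (intro allI impI)
    fix A assume "inner_node (representing_tree X d) A"
    then have A: "A \<in> rep_nodes d X" "\<not> (\<exists>x. A = {x})"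
      using leaf_representing_tree_iff[OF um fin ne]
      by (auto simp: inner_node_def representing_tree_def)
    note A' = rep_node[OF A(1)]
    obtain x where x: "x \<in> A" using A'(2) by blast
    then obtain y where y: "y \<in> A" "d x y = diam d A" using A'(1) by (blast elim: diam_from_point)
    obtain x' where x': "x' \<in> A" "x' \<noteq> x" using A(2) x by blast
    \<comment> \<open>Two distinct points make \<open>diam d A\<close> positive, so \<open>y\<close>
      differs from \<open>x\<close> and the assumption applies to this pair.\<close>
    have "0 < d x x'" using um_pos x x' A'(1) by blast
    then have "x \<noteq> y" "2 \<le> card A"
      using diam_ge[OF A'(3) x x'(1), of d] y um_simps(2)[of x x] x x' A'
      by (auto simp: numeral_2_eq_2 not_less_eq_eq[symmetric] card_le_Suc0_iff_eq)
    then obtain w where w: "w \<in> X" "d x w \<le> diam d A" "\<forall>z\<in>X - {w}. diam d A \<le> d w z"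
      using R x y A'(1) by (metis subsetD)
    \<comment> \<open>Points outside \<open>A\<close> are farther than \<open>diam d A\<close> from
      \<open>x\<close>, so \<open>w\<close> is in \<open>A\<close>. There its distances to other
      points are bounded by \<open>diam d A\<close> from both sides.\<close>
    have w_A: "w \<in> A" using diam_less_dist_outside[OF A(1) x, of w] w(1,2) by force
    have "d w z = diam d A" if "z \<in> A - {w}" for z
      using diam_ge[OF A'(3) w_A, of z d] w(3) that A'(1) by (blast intro: antisym)
    moreover have "d w w \<noteq> diam d A"
      using \<open>0 < d x x'\<close> diam_ge[OF A'(3) x x'(1), of d] um_simps(2)[of w w] w(1) by auto
    ultimately have "{v \<in> A. d w v \<noteq> diam d A} = {w}" using w_A by auto
    then have "rep_child d A {w}"
      using rep_child_exists[OF ultrametric_space_subset[OF um A'(1)] A'(3) \<open>2 \<le> card A\<close> w_A]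
      by simp
    moreover from this have "leaf (representing_tree X d) {w}"
      using leaf_representing_tree_iff[OF um fin ne] A(1) by (blast intro: rep_nodes.child)
    ultimately show "\<exists>B. (A, B) \<in> parcs (representing_tree X d) \<and> leaf (representing_tree X d) B"
      using A(1) by (auto simp: representing_tree_def)
  qed
qed

end

section \<open>From labeled trees to isolated points and back\<close>

lemma label_le_tree_dist:
  assumes "unrooted_tree T" "u \<in> pverts T" "v \<in> pverts T" "u \<noteq> v"
  shows "l u \<le> tree_dist T l u v"
  using assms(4) joinsD[OF joins_joining_path[OF assms(1-3)]] by (simp add: tree_dist_def)

text \<open>Every path from \<open>w\<close> contains \<open>w\<close>, so \<open>l w\<close> bounds
  all distances from \<open>w\<close> to other vertices below. The path from \<open>x\<close> to
  \<open>w\<close> is a prefix of the path from \<open>x\<close> to \<open>y\<close>, so its largest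
  label is no larger.\<close>

lemma tree_dist_isolated_point:
  assumes T: "labeled_tree T l" and x: "x \<in> pverts T" and y: "y \<in> pverts T" and "x \<noteq> y"
  shows "\<exists>w\<in>pverts T. tree_dist T l x w \<le> tree_dist T l x y \<and>
    (\<forall>z\<in>pverts T - {w}. tree_dist T l x y \<le> tree_dist T l w z)"
proof -
  have tree: "unrooted_tree T" using T by (simp add: labeled_tree_def)
  define p where "p = joining_path T x y"
  have p: "joins T x y p" unfolding p_def using tree x y by (rule joins_joining_path)
  have dist: "tree_dist T l x y = Max (l ` set p)"
    using \<open>x \<noteq> y\<close> by (simp add: tree_dist_def p_def)
  then have "tree_dist T l x y \<in> l ` set p"
    using joinsD(1)[OF p] by simp
  then obtain w where w: "w \<in> set p" "l w = tree_dist T l x y" by auto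
  then have w_T: "w \<in> pverts T" using joinsD(3)[OF p] by blast
  obtain xs ys where p_split: "p = xs @ w # ys" using w(1) by (auto simp: in_set_conv_decomp)
  have "joining_path T x w = xs @ [w]"
    using joining_path_eq[OF tree joins_prefix] p p_split by metis
  then have "tree_dist T l x w \<le> tree_dist T l x y"
  proof (cases "x = w")
    case True
    \<comment> \<open>For \<open>x = w\<close> the distance is 0 by definition and not a maximum of
      labels; nonnegativity of the labels settles this case.\<close>
    have "0 \<le> l x" using T x by (simp add: labeled_tree_def)
    then show ?thesis
      using True label_le_tree_dist[OF tree x y \<open>x \<noteq> y\<close>, of l] by (simp add: tree_dist_def)
  next
    case False
    assume "joining_path T x w = xs @ [w]"
    then have "tree_dist T l x w = Max (l ` set (xs @ [w]))"
      using False by (simp only: tree_dist_def if_False)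
    also have "\<dots> \<le> Max (l ` set p)"
      using p_split by (intro Max_mono) auto
    finally show ?thesis using dist by simp
  qed
  moreover have "\<forall>z\<in>pverts T - {w}. tree_dist T l x y \<le> tree_dist T l w z"
    using label_le_tree_dist[OF tree w_T] w(2) by (metis DiffE insertI1)
  ultimately show ?thesis using w_T by blast
qed

text \<open>
  Induction removing a point \<open>y\<close> of a closest pair. If \<open>\<delta>\<close> is the least distance, then \<open>y\<close> can be
  chosen such that \<open>d w y = \<delta> = l w\<close> for some \<open>w\<close>. As \<open>l y \<le> \<delta> \<le> d w z = d y z\<close> for all other
  points \<open>z\<close>, the leaf \<open>y\<close> can be attached to \<open>w\<close>.
\<close>

lemma tree_of_labels:
  assumes "finite X" "X \<noteq> {}" "ultrametric_space X d"
    and "\<And>x y. x \<in> X \<Longrightarrow> y \<in> X \<Longrightarrow> x \<noteq> y \<Longrightarrow> l x \<le> d x y"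
    and "\<And>x y. x \<in> X \<Longrightarrow> y \<in> X \<Longrightarrow> x \<noteq> y \<Longrightarrow> \<exists>w\<in>X. d x w \<le> d x y \<and> l w = d x y"
  shows "\<exists>T. unrooted_tree T \<and> pverts T = X \<and> (\<forall>x\<in>X. \<forall>y\<in>X. tree_dist T l x y = d x y)"
  using assms
proof (induction X rule: finite_psubset_induct)
  case (psubset X)
  note um = \<open>ultrametric_space X d\<close>
  note le = psubset.prems(3) and ex = psubset.prems(4)
  have d0: "d x x = 0" if "x \<in> X" for x using um that unfolding ultrametric_space_iff by blast
  have sym: "d x y = d y x" if "x \<in> X" "y \<in> X" for x y
    using um that unfolding ultrametric_space_iff by blast
  have max: "d x z \<le> max (d x y) (d y z)" if "x \<in> X" "y \<in> X" "z \<in> X" for x y z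
    using um that unfolding ultrametric_space_iff by blast
  show ?case
  proof (cases "\<exists>x. X = {x}")
    case True
    then obtain x where X: "X = {x}" by blast
    have "tree_dist \<lparr>pverts = {x}, parcs = {}\<rparr> l x x = d x x"
      using d0[of x] X by (simp add: tree_dist_def)
    then show ?thesis
      unfolding X using unrooted_tree_singleton[of x]
      by (intro exI[of _ "\<lparr>pverts = {x}, parcs = {}\<rparr>"]) simp
  next
    case False
    let ?P = "{(x, y). x \<in> X \<and> y \<in> X \<and> x \<noteq> y}"
    have "finite ?P"
      by (rule finite_subset[of _ "X \<times> X"]) (use psubset.hyps in auto)
    moreover have "?P \<noteq> {}" using False \<open>X \<noteq> {}\<close> by blast
    ultimately obtain e where e: "e \<in> ?P" "\<forall>e'\<in>?P. case_prod d e \<le> case_prod d e'"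
      using ex_min_if_finite[of "case_prod d ` ?P"] by (auto simp: not_less)
    obtain a b where e_eq: "e = (a, b)" by fastforce
    have ab: "a \<in> X" "b \<in> X" "a \<noteq> b" using e(1) e_eq by auto
    have min: "d a b \<le> d u v" if "u \<in> X" "v \<in> X" "u \<noteq> v" for u v
      using e(2) that e_eq by auto
    obtain w where w: "w \<in> X" "d a w \<le> d a b" "l w = d a b" using ex[OF ab] by blast
    \<comment> \<open>If \<open>w\<close> is not \<open>a\<close>, then \<open>y = a\<close>, and
      \<open>d a w\<close> is at most the minimum \<open>d a b\<close>. So \<open>w\<close> and
      \<open>y\<close> form a closest pair in either case.\<close>
    define y where "y = (if w = a then b else a)"
    have y: "y \<in> X" "y \<noteq> w" using ab by (auto simp: y_def)
    have "d w y \<le> d a b" using w(2) sym[of a w] ab w(1) by (auto simp: y_def)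
    then have wy: "d w y = d a b" using min[of w y] w(1) y by auto
    have ly: "l y \<le> d a b" using le[of y w] sym[of y w] wy w(1) y by auto
    have far: "d y z = d w z" if z: "z \<in> X" "z \<noteq> y" "z \<noteq> w" for z
    proof -
      \<comment> \<open>Isosceles triangle: neither \<open>d w z\<close> nor \<open>d y z\<close> is
        below \<open>d w y\<close>, so the ultrametric inequality bounds each by the other.\<close>
      have "d a b \<le> d w z" "d a b \<le> d y z" using min w(1) y z by auto
      then show ?thesis
        using max[of y w z] max[of w y z] sym[of w y] wy w(1) y(1) z(1) by auto
    qed
    let ?X = "X - {y}"
    have "\<exists>T. unrooted_tree T \<and> pverts T = ?X \<and> (\<forall>x\<in>?X. \<forall>y\<in>?X. tree_dist T l x y = d x y)"
    proof (rule psubset.IH)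
      show "?X \<subset> X" "?X \<noteq> {}" using w(1) y by auto
      show "ultrametric_space ?X d" using ultrametric_space_subset[OF um] by blast
      show "l p \<le> d p q" if "p \<in> ?X" "q \<in> ?X" "p \<noteq> q" for p q using le that by blast
      show "\<exists>v\<in>?X. d p v \<le> d p q \<and> l v = d p q" if pq: "p \<in> ?X" "q \<in> ?X" "p \<noteq> q" for p q
      proof -
        obtain v where v: "v \<in> X" "d p v \<le> d p q" "l v = d p q" using ex pq by blast
        show ?thesis
        proof (cases "v = y")
          case True
          \<comment> \<open>If the removed point \<open>y\<close> was the witness, then
            \<open>d p q = l y\<close> is at most, hence equal to, the least distance. As
            \<open>l w\<close> has this value too and \<open>w\<close> is that close to
            \<open>y\<close>, the point \<open>w\<close> takes over.\<close>
          then have "d p q = d a b" using v(3) ly min[of p q] pq by auto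
          moreover have "d p w \<le> d p q"
            using max[of p y w] v(2) True wy sym[of w y] pq w(1) y(1) calculation by auto
          ultimately show ?thesis using w(1,3) y(2) by auto
        next
          case False
          then show ?thesis using v by blast
        qed
      qed
    qed
    then obtain T where T: "unrooted_tree T" "pverts T = ?X"
      and dist: "\<And>u v. u \<in> ?X \<Longrightarrow> v \<in> ?X \<Longrightarrow> tree_dist T l u v = d u v" by blast
    have w_T: "w \<in> pverts T" and y_T: "y \<notin> pverts T" using w(1) y T(2) by auto
    let ?T = "add_leaf T w y"
    have tree: "unrooted_tree ?T" by (rule unrooted_tree_add_leaf[OF T(1) w_T y_T])
    have verts: "pverts ?T = X" using y(1) T(2) by (auto simp: add_leaf_def)
    have leaf: "tree_dist ?T l y v = d y v" if v: "v \<in> ?X" for v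
    proof (cases "v = w")
      case True
      then show ?thesis
        using tree_dist_leaf[OF T(1) w_T y_T w_T, of l] ly w(3) wy sym[of w y] w(1) y(1) by simp
    next
      case False
      have "tree_dist ?T l y v = max (l y) (d w v)"
        using tree_dist_leaf[OF T(1) w_T y_T, of v l] False v T(2) dist[of w v] w(1) y(2) by simp
      moreover have "l y \<le> d w v" using ly min[of w v] False v w(1) by auto
      ultimately show ?thesis using far[of v] False v by simp
    qed
    have "tree_dist ?T l u v = d u v" if uv: "u \<in> X" "v \<in> X" for u v
    proof -
      consider "u = v" | "u \<in> ?X" "v \<in> ?X" | "u = y" "v \<in> ?X" | "v = y" "u \<in> ?X"
        using uv by blast
      then show ?thesis
      proof cases
        case 1
        then show ?thesis using d0 uv by (simp add: tree_dist_def)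
      next
        case 2
        then show ?thesis
          using tree_dist_add_leaf[OF T(1) w_T y_T, of u v l] dist T(2) by simp
      next
        case 3
        then show ?thesis using leaf by simp
      next
        case 4
        then show ?thesis
          using leaf[of u] tree_dist_commute[OF tree, of u v l] sym[of u v] uv verts by simp
      qed
    qed
    then show ?thesis using tree verts by blast
  qed
qed

text \<open>Nearest-neighbour distances meet the hypotheses on labels in
  \<open>tree_of_labels\<close>: the isolated point \<open>w\<close> for \<open>x\<close> and
  \<open>y\<close> gets exactly the label \<open>d x y\<close>.\<close>

lemma tree_of_isolated_points:
  assumes um: "ultrametric_space X d" and fin: "finite X" and card: "2 \<le> card X"
    and iso: "\<And>x y. x \<in> X \<Longrightarrow> y \<in> X \<Longrightarrow> x \<noteq> y \<Longrightarrow>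
      \<exists>w\<in>X. d x w \<le> d x y \<and> (\<forall>z\<in>X - {w}. d x y \<le> d w z)"
  shows "\<exists>T l. labeled_tree T l \<and> pverts T = X \<and> (\<forall>x\<in>X. \<forall>y\<in>X. tree_dist T l x y = d x y)"
proof -
  define l where "l x = Min (d x ` (X - {x}))" for x
  have other: "X - {x} \<noteq> {}" for x
  proof
    assume "X - {x} = {}"
    then have "card X \<le> card {x}" by (intro card_mono) auto
    then show False using card by simp
  qed
  have le: "l x \<le> d x y" if "y \<in> X" "x \<noteq> y" for x y
    unfolding l_def using fin that by (intro Min_le) auto
  have in_l: "\<exists>z\<in>X - {x}. l x = d x z" for x
  proof -
    have "l x \<in> d x ` (X - {x})" unfolding l_def using fin other[of x] by (intro Min_in) auto
    then show ?thesis by blast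
  qed
  have "0 \<le> l x" if "x \<in> X" for x
    using in_l[of x] um that unfolding ultrametric_space_iff by auto
  moreover have "\<exists>T. unrooted_tree T \<and> pverts T = X \<and> (\<forall>x\<in>X. \<forall>y\<in>X. tree_dist T l x y = d x y)"
  proof (rule tree_of_labels[OF fin _ um])
    show "X \<noteq> {}" using card by auto
    fix x y assume xy: "x \<in> X" "y \<in> X" "x \<noteq> y"
    show "l x \<le> d x y" using le xy by blast
    obtain w where w: "w \<in> X" "d x w \<le> d x y" "\<forall>z\<in>X - {w}. d x y \<le> d w z"
      using iso xy by blast
    have "d x y \<le> l w" using in_l[of w] w(3) by auto
    \<comment> \<open>Some point other than \<open>w\<close> lies within \<open>d x y\<close> of it:
      \<open>y\<close> if \<open>w = x\<close>, and \<open>x\<close> otherwise.\<close>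
    moreover have "l w \<le> d x y"
    proof (cases "w = x")
      case True
      then show ?thesis using le xy by blast
    next
      case False
      have "d w x = d x w" using um xy w(1) unfolding ultrametric_space_iff by blast
      then show ?thesis using le[of x w] False xy w(2) by simp
    qed
    ultimately show "\<exists>w\<in>X. d x w \<le> d x y \<and> l w = d x y" using w by force
  qed
  ultimately show ?thesis unfolding labeled_tree_def by blast
qed

theorem theorem4p1:
  shows "(\<forall>(T :: 'a pair_pre_digraph) (l :: 'a \<Rightarrow> real).
            labeled_tree T l \<and> finite (pverts T) \<and> 2 \<le> card (pverts T) \<and>
            ultrametric_space (pverts T) (tree_dist T l) \<longrightarrow>
            inner_nodes_have_leaf_child (representing_tree (pverts T) (tree_dist T l))) \<and>
         (\<forall>(X :: 'b set) (d :: 'b \<Rightarrow> 'b \<Rightarrow> real).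
            ultrametric_space X d \<and> finite X \<and> 2 \<le> card X \<and>
            inner_nodes_have_leaf_child (representing_tree X d) \<longrightarrow>
            (\<exists>(T :: 'b pair_pre_digraph) (l :: 'b \<Rightarrow> real).
               labeled_tree T l \<and> pverts T = X \<and>
               (\<forall>x\<in>X. \<forall>y\<in>X. tree_dist T l x y = d x y)))"
proof (intro conjI allI impI; elim conjE)
  fix T :: "'a pair_pre_digraph" and l :: "'a \<Rightarrow> real"
  assume T: "labeled_tree T l" "finite (pverts T)" "2 \<le> card (pverts T)"
    "ultrametric_space (pverts T) (tree_dist T l)"
  then have "pverts T \<noteq> {}" by auto
  then show "inner_nodes_have_leaf_child (representing_tree (pverts T) (tree_dist T l))"
    using inner_nodes_have_leaf_child_iff[OF T(4,2)] tree_dist_isolated_point[OF T(1)] by blast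
next
  fix X :: "'b set" and d :: "'b \<Rightarrow> 'b \<Rightarrow> real"
  assume X: "ultrametric_space X d" "finite X" "2 \<le> card X"
    "inner_nodes_have_leaf_child (representing_tree X d)"
  then have "X \<noteq> {}" by auto
  then have "\<forall>x\<in>X. \<forall>y\<in>X. x \<noteq> y \<longrightarrow>
      (\<exists>w\<in>X. d x w \<le> d x y \<and> (\<forall>z\<in>X - {w}. d x y \<le> d w z))"
    using inner_nodes_have_leaf_child_iff[OF X(1,2)] X(4) by blast
  then show "\<exists>T l. labeled_tree T l \<and> pverts T = X \<and>
      (\<forall>x\<in>X. \<forall>y\<in>X. tree_dist T l x y = d x y)"
    using tree_of_isolated_points[OF X(1-3)] by blast
qed

end
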